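(* Let $\gamma_y(t)=(y^0,y^1,y^2,y^3,y^4)(t)$ be a smooth curve in $\mathbb R^5$ (coordinates $y^0,\dots,y^4$) with $\dot y^4(t)\neq0$ for all $t$, tangent to the rank 2 distribution $$\mathcal D_2=\mathrm{Span}\big(\partial_{y^4},\ \partial_{y^3}-2y^4\partial_{y^2}+3(y^4)^2\partial_{y^1}+3y^2\partial_{y^0}\big),$$ i.e. $\dot y^0=3y^2\dot y^3$, $\dot y^1=3(y^4)^2\dot y^3$, $\dot y^2=-2y^4\dot y^3$. Put $y^5(t)=\dot y^3(t)/\dot y^4(t)$ and let $\gamma_x(t)=(x^0,x^1,x^2,x^3,x^4)(t)$ be the curve in $\mathbb R^5$ (coordinates $x^0,\dots,x^4$) given by $$\begin{aligned}x^0&=y^0-y^1y^5-3y^2y^4y^5-(y^4)^3(y^5)^2,\quad x^1=y^1-(y^4)^3y^5,\\ x^2&=y^2+(y^4)^2y^5,\quad x^3=y^3-y^4y^5,\quad x^4=y^5 .\end{aligned}$$ Then $\gamma_x$ is tangent to the contact distribution $\mathcal D_4$ spanned by $$Z_1=\partial_{x^4}-x^1\partial_{x^0},\quad Z_2=\partial_{x^3}+3x^2\partial_{x^0},\quad Z_3=\partial_{x^2},\quad Z_4=\partial_{x^1},$$ and $$\dot\gamma_x=\frac{\mathrm d}{\mathrm dt}\Big(\frac{\dot y^3}{\dot y^4}\Big)\big(Z_1-y^4Z_2+(y^4)^2Z_3-(y^4)^3Z_4\big),$$ so its velocity lies on the twisted cubic $Z_1+TZ_2+T^2Z_3+T^3Z_4$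 with $T(t)=-y^4(t)$. In particular $\gamma_x$ is simultaneously null with respect to the three bilinear forms $g^1=\mathrm dx^1\mathrm dx^3-(\mathrm dx^2)^2$, $g^2=(\mathrm dx^3)^2-\mathrm dx^2\mathrm dx^4$, $g^3=\mathrm dx^1\mathrm dx^4-\mathrm dx^2\mathrm dx^3$ on $\mathcal D_4$.
   Context: Here $\mathcal D_2$ is the local coordinate form of the flat, $G_2$-invariant $(2,3,5)$ distribution on $G_2/P_1$, and $\mathcal D_4=\ker(\mathrm dx^0+x^1\mathrm dx^4-3x^2\mathrm dx^3)$ with the module $\mathrm{Span}(g^1,g^2,g^3)$ is the local coordinate form of the flat $G_2$-invariant contact structure on $G_2/P_2$ ($G_2$ being the split real form). The curve $\gamma_x$ is obtained by lifting $\gamma_y$ to $G_2/P_{1,2}$, viewed as the bundle of directions in $\mathcal D_2$ with fibre coordinate $y^5$, and projecting to $G_2/P_2$. Products of 1-forms are symmetric. A curve is null with respect to a bilinear form $g$ if $g(\dot\gamma,\dot\gamma)=0$ at all times. *)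

theory Defs
  imports "HOL-Analysis.Analysis"
begin

section \<open>Curves in Euclidean space\<close>

definition velocity :: "(real \<Rightarrow> 'a::real_normed_vector) \<Rightarrow> real \<Rightarrow> 'a" where
  "velocity \<gamma> t = vector_derivative \<gamma> (at t)"

(* Meant for open I: the two-sided derivatives of all orders exist on I. *)
definition smooth_curve_on :: "real set \<Rightarrow> (real \<Rightarrow> 'a::real_normed_vector) \<Rightarrow> bool" where
  "smooth_curve_on I \<gamma> \<longleftrightarrow> (\<forall>k. (velocity ^^ k) \<gamma> differentiable_on I)"

definition tangent_on ::
    "('a \<Rightarrow> 'a set) \<Rightarrow> real set \<Rightarrow> (real \<Rightarrow> 'a::real_normed_vector) \<Rightarrow> bool" where
  "tangent_on D I \<gamma> \<longleftrightarrow> (\<forall>t\<in>I. \<exists>v\<in>D (\<gamma> t). (\<gamma> has_vector_derivative v) (at t))"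

(* The forms below have constant coefficients, so g does not depend on the base point. *)
definition null_on ::
    "('a \<Rightarrow> 'a \<Rightarrow> real) \<Rightarrow> real set \<Rightarrow> (real \<Rightarrow> 'a::real_normed_vector) \<Rightarrow> bool" where
  "null_on g I \<gamma> \<longleftrightarrow> (\<forall>t\<in>I. \<exists>v. (\<gamma> has_vector_derivative v) (at t) \<and> g v v = 0)"

section \<open>Coordinates on five-dimensional space\<close>

text \<open>The index type 5 consists of the residues 0, 1, 2, 3, 4, so the coordinates of
  a point p are p $ 0, ..., p $ 4.\<close>

definition vec5 :: "real \<Rightarrow> real \<Rightarrow> real \<Rightarrow> real \<Rightarrow> real \<Rightarrow> real^5" where
  "vec5 a0 a1 a2 a3 a4 =
    (\<chi> i. if i = 0 then a0 else if i = 1 then a1 else if i = 2 then a2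
         else if i = 3 then a3 else a4)"

abbreviation pd :: "5 \<Rightarrow> real^5" where
  "pd i \<equiv> axis i 1"

definition dx :: "5 \<Rightarrow> real^5 \<Rightarrow> real" where
  "dx i v = v $ i"

text \<open>Symmetric product of 1-forms, normalised so that the product of a form with itself,
  evaluated on (v, v), is its squared value on v.\<close>

definition sym_prod :: "('a \<Rightarrow> real) \<Rightarrow> ('a \<Rightarrow> real) \<Rightarrow> 'a \<Rightarrow> 'a \<Rightarrow> real" where
  "sym_prod \<alpha> \<beta> v w = (\<alpha> v * \<beta> w + \<beta> v * \<alpha> w) / 2"

lemma exhaust_5: "(i::5) = 0 \<or> i = 1 \<or> i = 2 \<or> i = 3 \<or> i = 4"
proof (induct i)
  case (of_int z)
  then have "z = 0 \<or> z = 1 \<or> z = 2 \<or> z = 3 \<or> z = 4" by fastforce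
  then show ?case by auto
qed

lemma vec5_nth [simp]:
  "vec5 a0 a1 a2 a3 a4 $ 0 = a0" "vec5 a0 a1 a2 a3 a4 $ 1 = a1"
  "vec5 a0 a1 a2 a3 a4 $ 2 = a2" "vec5 a0 a1 a2 a3 a4 $ 3 = a3"
  "vec5 a0 a1 a2 a3 a4 $ 4 = a4"
  by (simp_all add: vec5_def)

lemma vec_eq_iff_5:
  fixes v w :: "real^5"
  shows "v = w \<longleftrightarrow> v $ 0 = w $ 0 \<and> v $ 1 = w $ 1 \<and> v $ 2 = w $ 2 \<and> v $ 3 = w $ 3 \<and> v $ 4 = w $ 4"
  (is "_ \<longleftrightarrow> ?R")
proof
  assume ?R
  have "v $ i = w $ i" for i
    using exhaust_5[of i] \<open>?R\<close> by (elim disjE) simp_all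
  then show "v = w" by (simp add: vec_eq_iff)
qed simp

section \<open>The (2,3,5) distribution\<close>

definition D2 :: "real^5 \<Rightarrow> (real^5) set" where
  "D2 y = span {pd 4,
     pd 3 - (2 * y $ 4) *\<^sub>R pd 2 + (3 * (y $ 4)\<^sup>2) *\<^sub>R pd 1 + (3 * y $ 2) *\<^sub>R pd 0}"

lemma D2_iff:
  "v \<in> D2 y \<longleftrightarrow> v $ 0 = 3 * y $ 2 * v $ 3 \<and> v $ 1 = 3 * (y $ 4)\<^sup>2 * v $ 3 \<and>
     v $ 2 = - 2 * y $ 4 * v $ 3"
  (is "_ \<longleftrightarrow> ?R")
proof -
  let ?w = "pd 3 - (2 * y $ 4) *\<^sub>R pd 2 + (3 * (y $ 4)\<^sup>2) *\<^sub>R pd 1 + (3 * y $ 2) *\<^sub>R pd 0"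
  have "v \<in> D2 y \<longleftrightarrow> (\<exists>a b. v - a *\<^sub>R pd 4 = b *\<^sub>R ?w)"
    unfolding D2_def span_breakdown_eq span_singleton by blast
  also have "\<dots> \<longleftrightarrow> ?R"
  proof
    assume "\<exists>a b. v - a *\<^sub>R pd 4 = b *\<^sub>R ?w"
    then obtain a b where "v - a *\<^sub>R pd 4 = b *\<^sub>R ?w" by blast
    then show ?R by (simp add: vec_eq_iff_5 axis_def)
  next
    assume ?R
    then have "v - (v $ 4) *\<^sub>R pd 4 = (v $ 3) *\<^sub>R ?w" by (simp add: vec_eq_iff_5 axis_def)
    then show "\<exists>a b. v - a *\<^sub>R pd 4 = b *\<^sub>R ?w" by blast
  qed
  finally show ?thesis .
qed

section \<open>The contact distribution\<close>

definition Z1 :: "real^5 \<Rightarrow> real^5" where "Z1 x = pd 4 - (x $ 1) *\<^sub>R pd 0"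
definition Z2 :: "real^5 \<Rightarrow> real^5" where "Z2 x = pd 3 + (3 * x $ 2) *\<^sub>R pd 0"
definition Z3 :: "real^5 \<Rightarrow> real^5" where "Z3 x = pd 2"
definition Z4 :: "real^5 \<Rightarrow> real^5" where "Z4 x = pd 1"

definition D4 :: "real^5 \<Rightarrow> (real^5) set" where
  "D4 x = span {Z1 x, Z2 x, Z3 x, Z4 x}"

lemma D4_eq_kernel:
  "D4 x = {v. dx 0 v + x $ 1 * dx 4 v - 3 * x $ 2 * dx 3 v = 0}"
proof (intro equalityI subsetI)
  fix v assume "v \<in> D4 x"
  then obtain a b c d where "v - a *\<^sub>R Z1 x - b *\<^sub>R Z2 x - c *\<^sub>R Z3 x = d *\<^sub>R Z4 x"
    unfolding D4_def span_breakdown_eq span_singleton by blast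
  then show "v \<in> {v. dx 0 v + x $ 1 * dx 4 v - 3 * x $ 2 * dx 3 v = 0}"
    by (simp add: vec_eq_iff_5 axis_def dx_def Z1_def Z2_def Z3_def Z4_def algebra_simps)
next
  fix v assume "v \<in> {v. dx 0 v + x $ 1 * dx 4 v - 3 * x $ 2 * dx 3 v = 0}"
  then have "v - (v $ 4) *\<^sub>R Z1 x - (v $ 3) *\<^sub>R Z2 x - (v $ 2) *\<^sub>R Z3 x = (v $ 1) *\<^sub>R Z4 x"
    by (simp add: vec_eq_iff_5 axis_def dx_def Z1_def Z2_def Z3_def Z4_def algebra_simps)
  then show "v \<in> D4 x"
    unfolding D4_def span_breakdown_eq span_singleton by blast
qed

definition twisted_cubic :: "real^5 \<Rightarrow> real \<Rightarrow> real^5" where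
  "twisted_cubic x T = Z1 x + T *\<^sub>R Z2 x + T\<^sup>2 *\<^sub>R Z3 x + T^3 *\<^sub>R Z4 x"

definition g1 :: "real^5 \<Rightarrow> real^5 \<Rightarrow> real" where
  "g1 v w = sym_prod (dx 1) (dx 3) v w - sym_prod (dx 2) (dx 2) v w"

definition g2 :: "real^5 \<Rightarrow> real^5 \<Rightarrow> real" where
  "g2 v w = sym_prod (dx 3) (dx 3) v w - sym_prod (dx 2) (dx 4) v w"

definition g3 :: "real^5 \<Rightarrow> real^5 \<Rightarrow> real" where
  "g3 v w = sym_prod (dx 1) (dx 4) v w - sym_prod (dx 2) (dx 3) v w"

section \<open>From curves in the y-space to curves in the x-space\<close>

text \<open>The projection of the point of the direction bundle of D2 with base point y and
  fibre coordinate y5.\<close>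

definition proj_x :: "real^5 \<Rightarrow> real \<Rightarrow> real^5" where
  "proj_x y y5 = vec5
     (y $ 0 - y $ 1 * y5 - 3 * y $ 2 * y $ 4 * y5 - (y $ 4)^3 * y5\<^sup>2)
     (y $ 1 - (y $ 4)^3 * y5)
     (y $ 2 + (y $ 4)\<^sup>2 * y5)
     (y $ 3 - y $ 4 * y5)
     y5"

definition curve_x :: "(real \<Rightarrow> real^5) \<Rightarrow> real \<Rightarrow> real^5" where
  "curve_x \<gamma> t = proj_x (\<gamma> t) (velocity \<gamma> t $ 3 / velocity \<gamma> t $ 4)"

end

theory Submission
  imports Defs
begin

text \<open>Write s for the fibre coordinate y5 and u for its derivative. Tangency to D2 together
  with \<open>dy3/dt = s dy4/dt\<close> makes every term of the velocity of the projected curve that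
  does not contain u cancel, and the remaining coefficient of u is a point of the twisted
  cubic. The three forms vanish because (v1, v2, v3, v4) is proportional to
  \<open>(T^3, T^2, T, 1)\<close>, and they generate the quadrics through the twisted cubic.\<close>

lemma has_vector_derivative_vec_nth:
  fixes f :: "real \<Rightarrow> real^'n"
  assumes "(f has_vector_derivative v) F"
  shows "((\<lambda>t. f t $ i) has_vector_derivative v $ i) F"
  using bounded_linear.has_vector_derivative[OF bounded_linear_vec_nth assms] .

text \<open>Over fixed axis vectors each summand is a bounded linear image of one scalar function,
  so \<open>vec5\<close> can be differentiated entry by entry.\<close>

lemma vec5_eq_sum_axis:
  "vec5 a b c d e =
    a *\<^sub>R axis 0 1 + b *\<^sub>R axis 1 1 + c *\<^sub>R axis 2 1 + d *\<^sub>R axis 3 1 + e *\<^sub>R axis 4 1"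
  by (simp add: vec_eq_iff_5 axis_def)

lemma has_vector_derivative_vec5:
  assumes "(a has_vector_derivative a') (at t)" "(b has_vector_derivative b') (at t)"
    "(c has_vector_derivative c') (at t)" "(d has_vector_derivative d') (at t)"
    "(e has_vector_derivative e') (at t)"
  shows "((\<lambda>t. vec5 (a t) (b t) (c t) (d t) (e t)) has_vector_derivative vec5 a' b' c' d' e') (at t)"
  unfolding vec5_eq_sum_axis
  by (intro has_vector_derivative_add
      bounded_linear.has_vector_derivative[OF bounded_linear_scaleR_left] assms)

text \<open>Odd powers of the parameter change sign; this links the alternating signs of the
  velocity formula to the parameter T = -y4.\<close>

lemma twisted_cubic_uminus:
  "twisted_cubic x (- T) = Z1 x - T *\<^sub>R Z2 x + T\<^sup>2 *\<^sub>R Z3 x - T^3 *\<^sub>R Z4 x"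
  by (simp add: twisted_cubic_def)

lemma twisted_cubic_nth:
  "twisted_cubic x T $ 0 = 3 * x $ 2 * T - x $ 1" "twisted_cubic x T $ 1 = T^3"
  "twisted_cubic x T $ 2 = T\<^sup>2" "twisted_cubic x T $ 3 = T" "twisted_cubic x T $ 4 = 1"
  by (simp_all add: twisted_cubic_def Z1_def Z2_def Z3_def Z4_def axis_def)

text \<open>Checked on the contact form that cuts out \<open>D4\<close>: its value is u times (3 x2
  T - x1) + x1 - 3 x2 T = 0.\<close>

lemma scaleR_twisted_cubic_in_D4: "u *\<^sub>R twisted_cubic x T \<in> D4 x"
  by (simp add: D4_eq_kernel dx_def twisted_cubic_nth algebra_simps)

lemma scaleR_twisted_cubic_null:
  fixes x :: "real^5" and u T :: real
  defines "v \<equiv> u *\<^sub>R twisted_cubic x T"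
  shows "g1 v v = 0" "g2 v v = 0" "g3 v v = 0"
  by (simp_all add: v_def g1_def g2_def g3_def sym_prod_def dx_def twisted_cubic_nth
      power2_eq_square power3_eq_cube)

lemma differentiable_at_velocity_nth_quotient:
  fixes \<gamma> :: "real \<Rightarrow> real^'n"
  assumes "open I" "smooth_curve_on I \<gamma>" "t \<in> I" "velocity \<gamma> t $ j \<noteq> 0"
  shows "(\<lambda>s. velocity \<gamma> s $ i / velocity \<gamma> s $ j) differentiable (at t)"
proof -
  \<comment> \<open>The order k = 1 of smoothness says that the velocity itself, not just the curve,
    is differentiable.\<close>
  have "(velocity ^^ 1) \<gamma> differentiable_on I"
    using assms(2) unfolding smooth_curve_on_def by blast
  then have "velocity \<gamma> differentiable (at t)"
    using assms(1,3) by (simp add: differentiable_on_eq_differentiable_at)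
  then obtain w where "(velocity \<gamma> has_vector_derivative w) (at t)"
    by (metis vector_derivative_works)
  then have "((\<lambda>s. velocity \<gamma> s $ k) has_vector_derivative w $ k) (at t)" for k
    by (rule has_vector_derivative_vec_nth)
  then have "(\<lambda>s. velocity \<gamma> s $ k) differentiable (at t)" for k
    by (rule differentiableI_vector)
  then show ?thesis
    using assms(4) by (intro differentiable_divide)
qed

text \<open>The chain rule, with the fibre coordinate an arbitrary differentiable function s. Its
  link to the curve is stated as a product, so the computation is purely polynomial.\<close>

lemma has_vector_derivative_proj_x:
  assumes "(\<gamma> has_vector_derivative v) (at t)" and "v \<in> D2 (\<gamma> t)"
    and "(s has_real_derivative u) (at t)" and "v $ 3 = s t * v $ 4"
  shows "((\<lambda>t. proj_x (\<gamma> t) (s t)) has_vector_derivative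
    u *\<^sub>R twisted_cubic (proj_x (\<gamma> t) (s t)) (- (\<gamma> t $ 4))) (at t)"
proof -
  have [derivative_intros]: "((\<lambda>t. \<gamma> t $ i) has_real_derivative v $ i) (at t)" for i
    using has_vector_derivative_vec_nth[OF assms(1)]
    by (simp add: has_real_derivative_iff_has_vector_derivative)
  note [derivative_intros] = assms(3)
  \<comment> \<open>Every component of v except \<open>v $ 4\<close> becomes a polynomial multiple
    of \<open>v $ 4\<close>; in each coordinate below these multiples cancel and only terms in u
    survive.\<close>
  have v: "v $ 0 = 3 * \<gamma> t $ 2 * (s t * v $ 4)" "v $ 1 = 3 * (\<gamma> t $ 4)\<^sup>2 * (s t * v $ 4)"
    "v $ 2 = - 2 * \<gamma> t $ 4 * (s t * v $ 4)" "v $ 3 = s t * v $ 4"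
    using assms(2,4) by (simp_all add: D2_iff)
  let ?x = "proj_x (\<gamma> t) (s t)" and ?T = "- (\<gamma> t $ 4)"
  \<comment> \<open>The terms in \<open>v $ 4\<close> have coefficients 3 y2 s (1 - 1) and y4^2 s^2
    (-3 + 6 - 3). Those in u give -(y1 + 3 y2 y4 + 2 y4^3 s), which is 3 x2 T - x1 with x1, x2
    expanded.\<close>
  have "((\<lambda>t. \<gamma> t $ 0 - \<gamma> t $ 1 * s t - 3 * \<gamma> t $ 2 * \<gamma> t $ 4 * s t - (\<gamma> t $ 4)^3 * (s t)\<^sup>2)
      has_real_derivative u * (3 * ?x $ 2 * ?T - ?x $ 1)) (at t)"
    by (rule derivative_eq_intros refl)+
      (simp add: v proj_x_def power2_eq_square power3_eq_cube, algebra)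
  moreover have "((\<lambda>t. \<gamma> t $ 1 - (\<gamma> t $ 4)^3 * s t) has_real_derivative u * ?T^3) (at t)"
    by (rule derivative_eq_intros refl)+
      (simp add: v power2_eq_square power3_eq_cube)
  moreover have "((\<lambda>t. \<gamma> t $ 2 + (\<gamma> t $ 4)\<^sup>2 * s t) has_real_derivative u * ?T\<^sup>2) (at t)"
    by (rule derivative_eq_intros refl)+ (simp add: v)
  moreover have "((\<lambda>t. \<gamma> t $ 3 - \<gamma> t $ 4 * s t) has_real_derivative u * ?T) (at t)"
    by (rule derivative_eq_intros refl)+ (simp add: v)
  moreover have "u *\<^sub>R twisted_cubic ?x ?T =
      vec5 (u * (3 * ?x $ 2 * ?T - ?x $ 1)) (u * ?T^3) (u * ?T\<^sup>2) (u * ?T) u"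
    by (simp add: vec_eq_iff_5 twisted_cubic_nth)
  \<comment> \<open>The fifth coordinate is s itself, with derivative u by assumption.\<close>
  ultimately show ?thesis
    using assms(3) has_vector_derivative_vec5
    unfolding proj_x_def[of "\<gamma> _"] has_real_derivative_iff_has_vector_derivative by presburger
qed

theorem mainTheorem6:
  fixes I :: "real set" and \<gamma> :: "real \<Rightarrow> real^5"
  assumes "open I" and "is_interval I"
    and "smooth_curve_on I \<gamma>"
    and "\<forall>t\<in>I. velocity \<gamma> t $ 4 \<noteq> 0"
    and "tangent_on D2 I \<gamma>"
  shows "tangent_on D4 I (curve_x \<gamma>) \<and>
    (\<forall>t\<in>I. (curve_x \<gamma> has_vector_derivative
        deriv (\<lambda>s. velocity \<gamma> s $ 3 / velocity \<gamma> s $ 4) t *\<^sub>R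
          (Z1 (curve_x \<gamma> t) - (\<gamma> t $ 4) *\<^sub>R Z2 (curve_x \<gamma> t)
            + (\<gamma> t $ 4)\<^sup>2 *\<^sub>R Z3 (curve_x \<gamma> t) - (\<gamma> t $ 4)^3 *\<^sub>R Z4 (curve_x \<gamma> t))) (at t)) \<and>
    (\<forall>t\<in>I. \<exists>c. velocity (curve_x \<gamma>) t = c *\<^sub>R twisted_cubic (curve_x \<gamma> t) (- (\<gamma> t $ 4))) \<and>
    null_on g1 I (curve_x \<gamma>) \<and> null_on g2 I (curve_x \<gamma>) \<and> null_on g3 I (curve_x \<gamma>)"
proof -
  define s where "s t = velocity \<gamma> t $ 3 / velocity \<gamma> t $ 4" for t
  let ?V = "\<lambda>t. deriv s t *\<^sub>R twisted_cubic (curve_x \<gamma> t) (- (\<gamma> t $ 4))"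
  have x: "curve_x \<gamma> = (\<lambda>t. proj_x (\<gamma> t) (s t))"
    by (simp add: fun_eq_iff curve_x_def s_def)
  have V: "(curve_x \<gamma> has_vector_derivative ?V t) (at t)" if t: "t \<in> I" for t
  proof -
    obtain v where v: "v \<in> D2 (\<gamma> t)" "(\<gamma> has_vector_derivative v) (at t)"
      using assms(5) t unfolding tangent_on_def by blast
    \<comment> \<open>By uniqueness of derivatives, the vector supplied by tangency is the one whose
      components define s; \<open>v $ 4\<close> is then nonzero and the quotient can be
      cleared.\<close>
    have "velocity \<gamma> t = v"
      using v(2) by (simp add: velocity_def vector_derivative_at)
    then have "v $ 3 = s t * v $ 4"
      using assms(4) t by (auto simp: s_def)
    moreover have "(s has_real_derivative deriv s t) (at t)"
      using differentiable_at_velocity_nth_quotient[OF assms(1,3) t] assms(4) t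
      by (simp add: s_def[abs_def] DERIV_deriv_iff_real_differentiable)
    ultimately show ?thesis
      unfolding x by (intro has_vector_derivative_proj_x[OF v(2,1)])
  qed
  have "tangent_on D4 I (curve_x \<gamma>)"
    unfolding tangent_on_def using V scaleR_twisted_cubic_in_D4 by blast
  moreover have "null_on g1 I (curve_x \<gamma>)" "null_on g2 I (curve_x \<gamma>)" "null_on g3 I (curve_x \<gamma>)"
    unfolding null_on_def using V scaleR_twisted_cubic_null by blast+
  moreover have "velocity (curve_x \<gamma>) t = ?V t" if "t \<in> I" for t
    using V[OF that] by (simp add: velocity_def vector_derivative_at)
  \<comment> \<open>The scalar c is \<open>deriv s t\<close>; folding the sign lemma turns the
    explicit combination of Z1, ..., Z4 into the twisted cubic at -y4.\<close>
  ultimately show ?thesis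
    using V unfolding twisted_cubic_uminus[symmetric] s_def[abs_def] by blast
qed

end
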